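(* For every $n\ge 1$ there exists a finite constant $\mathcal{C}_n$ (depending only on $n$) such that for all Lebesgue measurable sets $E_1,\dots,E_n\subset\mathfrak{M}^{n\times n}(\mathbb{R})$ of finite measure, $$\prod_{j=1}^{n}|E_j|^{\frac{1}{n^{2}}}\le \mathcal{C}_n\sup_{A_1\in E_1,\dots,A_n\in E_n}\big|\det(A_1+\dots+A_n)\big|.$$
   Context: $\mathfrak{M}^{n\times n}(\mathbb{R})$ is the space of real $n\times n$ matrices, identified with $\mathbb{R}^{n^2}$ via its entries; $|E|$ denotes the Lebesgue measure on $\mathbb{R}^{n^2}$, and $\det$ is the ordinary determinant of a square matrix. The supremum is the pointwise supremum over all choices $A_j\in E_j$. *)

theory Defs
  imports "HOL-Analysis.Analysis"
begin

end

(* Slicing a set E of matrices coordinate by coordinate, in lexicographic order, produces for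
   every position (i,k) two elements of E whose difference vanishes at all later positions, such
   that the product over (i,k) of their (i,k) entries is at least |E| up to a constant.  Now let
   E_j use the position (s j, t j), with s and t permutations.  Expanding the determinant
   in rows, an alternating sum of 2^n values det (A_1 + ... + A_n) equals the determinant whose
   row s j is the corresponding row of the difference chosen in E_j; up to a permutation of the
   columns this matrix is triangular.  When s and t run independently through the rows of a
   Latin square, every E_j visits every position exactly once, and the geometric mean of the n^2
   resulting bounds is the theorem, with constant 16^n. *)
theory Submission
  imports Defs
begin

section \<open>Slicing a set of large measure\<close>

text \<open>If the support of \<open>g\<close> spans a length D, then \<open>g\<close> exceeds half
  of the mean a / D at some \<open>t\<close>, and the support has a point at distance at least D / 4
  from \<open>t\<close>. An unbounded support makes the distance as large as desired. When
  \<open>g\<close> measures the slices of a set, the slice at \<open>t\<close> has to be large, the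
  one at \<open>s\<close> only nonempty.\<close>

lemma nn_integral_long_fibre:
  fixes g :: "real \<Rightarrow> ennreal"
  assumes a: "0 < a" "ennreal a \<le> (\<integral>\<^sup>+x. g x \<partial>lborel)"
  obtains s t b where "0 < b" "0 < g s" "ennreal b \<le> g t" "a / 8 \<le> \<bar>t - s\<bar> * b"
proof -
  define T where "T = {t. 0 < g t}"
  have "\<exists>s t b. 0 < b \<and> 0 < g s \<and> ennreal b \<le> g t \<and> a / 8 \<le> \<bar>t - s\<bar> * b"
  proof (cases "bounded T")
    case False
    then have "T \<noteq> {}" by auto
    then obtain t where t: "0 < g t" unfolding T_def by blast
    \<comment> \<open>\<open>g t\<close> may be infinite, so a finite positive number below it is
      taken.\<close>
    obtain b where b: "0 < b" "ennreal b \<le> g t"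
    proof (cases "g t")
      case (real r)
      then show thesis using t that[of r] by simp
    next
      case top
      then show thesis using that[of 1] by simp
    qed
    obtain s where s: "s \<in> T" "a / (8 * b) < dist t s"
      using False unfolding bounded_def by (meson not_le)
    then have "a / 8 \<le> \<bar>t - s\<bar> * b"
      using b by (simp add: dist_real_def field_simps)
    then show ?thesis using s b unfolding T_def by blast
  next
    case True
    define D where "D = Sup T - Inf T"
    have sub: "T \<subseteq> {Inf T..Sup T}"
      using True
      by (auto intro!: cInf_lower cSup_upper bounded_imp_bdd_above bounded_imp_bdd_below)
    have int: "(\<integral>\<^sup>+x. g x \<partial>lborel) \<le> K * ennreal D" if K: "\<And>t. g t \<le> K" and "Inf T \<le> Sup T" for K
    proof -
      have "(\<integral>\<^sup>+x. g x \<partial>lborel) \<le> (\<integral>\<^sup>+x. K * indicator {Inf T..Sup T} x \<partial>lborel)"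
      proof (intro nn_integral_mono)
        fix x
        show "g x \<le> K * indicator {Inf T..Sup T} x"
        proof (cases "x \<in> T")
          case True
          then show ?thesis using K sub by auto
        next
          case False
          then show ?thesis by (simp add: T_def)
        qed
      qed
      also have "\<dots> = K * ennreal D"
        using that by (simp add: nn_integral_cmult_indicator D_def)
      finally show ?thesis .
    qed
    have ne: "T \<noteq> {}"
    proof
      assume "T = {}"
      then have "g = (\<lambda>_. 0)" by (auto simp: T_def)
      then show False using a by (simp add: ennreal_le_iff2)
    qed
    then have le: "Inf T \<le> Sup T" using sub by fastforce
    have D: "0 < D"
    proof (rule ccontr)
      assume "\<not> 0 < D"
      \<comment> \<open>In \<open>ennreal\<close>, top times 0 is 0: a support of length zero would
        make the integral vanish even if \<open>g\<close> is infinite there.\<close>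
      with int[of top] le have "(\<integral>\<^sup>+x. g x \<partial>lborel) \<le> 0"
        by (simp add: D_def ennreal_neg)
      with a show False by simp
    qed
    \<comment> \<open>Half of the mean: if \<open>g\<close> stayed below \<open>b\<close>, the
      integral would be at most a / 2.\<close>
    define b where "b = a / (2 * D)"
    have b: "0 < b" using a D by (simp add: b_def)
    obtain t where t: "ennreal b \<le> g t"
    proof (rule ccontr)
      assume "\<not> thesis"
      then have "\<And>t. g t \<le> ennreal b" using that by (meson linear)
      from int[OF this le] a have "ennreal a \<le> ennreal (b * D)"
        using b D by (simp add: ennreal_mult) 
      then have "a \<le> a / 2" using a D b by (subst (asm) ennreal_le_iff) (auto simp: b_def)
      then show False using a by simp
    qed
    \<comment> \<open>One end of the hull of \<open>T\<close> is at distance at least D / 2 from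
      \<open>t\<close>. The end need not belong to \<open>T\<close>, so only D / 4 is claimed; times
      \<open>b\<close> this is a / 8.\<close>
    have "\<exists>s\<in>T. D / 4 \<le> \<bar>t - s\<bar>"
    proof (cases "D / 2 \<le> Sup T - t")
      case True
      then obtain s where "s \<in> T" "t + D / 4 < s"
        using less_cSupE[of "t + D / 4" T] ne D by force
      moreover from this have "D / 4 \<le> \<bar>t - s\<bar>" by linarith
      ultimately show ?thesis by blast
    next
      case False
      then have "Inf T < t - D / 4" using D unfolding D_def by (simp add: field_simps)
      then obtain s where "s \<in> T" "s < t - D / 4"
        using ne cInf_lessD by blast
      moreover from this have "D / 4 \<le> \<bar>t - s\<bar>" by linarith
      ultimately show ?thesis by blast
    qed
    then obtain s where "s \<in> T" "D / 4 \<le> \<bar>t - s\<bar>" by blast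
    moreover from this have "a / 8 \<le> \<bar>t - s\<bar> * b"
      using mult_right_mono[of "D / 4" "\<bar>t - s\<bar>" b] D b by (simp add: b_def)
    ultimately show ?thesis using t b unfolding T_def by blast
  qed
  then show thesis using that by blast
qed

text \<open>Coordinates are added in increasing order of \<open>f\<close>, so the new one
  \<open>x\<close> is last. The pairs for the old coordinates all come from one large slice and
  hence agree at \<open>x\<close>; the pair for \<open>x\<close> joins two slices and has no later
  coordinate to respect. Each coordinate costs a factor 8. The number \<open>a\<close> is a lower
  bound instead of the measure because slices may have infinite measure.\<close>

lemma PiM_lborel_staggered_pairs:
  fixes f :: "'i \<Rightarrow> 'r::linorder"
  assumes "finite I"
  shows "\<And>E a. E \<in> sets (\<Pi>\<^sub>M i\<in>I. (lborel :: real measure)) \<Longrightarrow> 0 < a \<Longrightarrow>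
    ennreal a \<le> emeasure (\<Pi>\<^sub>M i\<in>I. lborel) E \<Longrightarrow>
    \<exists>U V. (\<forall>i\<in>I. U i \<in> E \<and> V i \<in> E \<and> (\<forall>k\<in>I. f i < f k \<longrightarrow> U i k = V i k)) \<and>
      a / 8 ^ card I \<le> (\<Prod>i\<in>I. \<bar>V i i - U i i\<bar>)"
  using assms
proof (induction I rule: finite_ranking_induct[where f = f])
  case empty
  let ?P = "\<Pi>\<^sub>M i\<in>({} :: 'i set). (lborel :: real measure)"
  \<comment> \<open>The product over no coordinates is one point of mass 1, so \<open>a\<close> is
    at most 1, the value of the empty product.\<close>
  have "emeasure ?P E \<le> emeasure ?P (space ?P)"
    by (rule emeasure_space)
  also have "\<dots> = ennreal 1" by (simp add: space_PiM)
  finally have "ennreal a \<le> ennreal 1" by (rule order_trans[OF empty(3)])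
  then have "a \<le> 1" by (simp only: ennreal_le_iff zero_le_one)
  then show ?case by simp
next
  case (insert x S)
  show ?case
  proof (cases "x \<in> S")
    case True
    then show ?thesis using insert.IH insert.prems by (simp add: insert_absorb)
  next
    case False
    interpret product_sigma_finite "\<lambda>_::'i. lborel :: real measure" by standard
    define F where "F t = {y \<in> space (\<Pi>\<^sub>M i\<in>S. (lborel::real measure)). y(x := t) \<in> E}" for t
    note E[measurable] = insert.prems(1)
    have F[measurable]: "F t \<in> sets (\<Pi>\<^sub>M i\<in>S. lborel)" for t
      unfolding F_def by measurable
    have "emeasure (\<Pi>\<^sub>M i\<in>insert x S. lborel) E = (\<integral>\<^sup>+y. indicator E y \<partial>(\<Pi>\<^sub>M i\<in>insert x S. lborel))"
      by simp
    also have "\<dots> = (\<integral>\<^sup>+t. (\<integral>\<^sup>+y. indicator E (y(x := t)) \<partial>(\<Pi>\<^sub>M i\<in>S. lborel)) \<partial>lborel)"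
      by (rule product_nn_integral_insert_rev) (use insert.hyps False in auto)
    also have "\<dots> = (\<integral>\<^sup>+t. (\<integral>\<^sup>+y. indicator (F t) y \<partial>(\<Pi>\<^sub>M i\<in>S. lborel)) \<partial>lborel)"
      by (intro nn_integral_cong) (auto simp: F_def split: split_indicator)
    also have "\<dots> = (\<integral>\<^sup>+t. emeasure (\<Pi>\<^sub>M i\<in>S. lborel) (F t) \<partial>lborel)"
      by simp
    finally have "ennreal a \<le> (\<integral>\<^sup>+t. emeasure (\<Pi>\<^sub>M i\<in>S. lborel) (F t) \<partial>lborel)"
      using insert.prems(3) by simp
    then obtain s t b where b: "0 < b" "0 < emeasure (\<Pi>\<^sub>M i\<in>S. lborel) (F s)"
      "ennreal b \<le> emeasure (\<Pi>\<^sub>M i\<in>S. lborel) (F t)" "a / 8 \<le> \<bar>t - s\<bar> * b"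
      using nn_integral_long_fibre[OF insert.prems(2)] by metis
    from insert.IH[OF F b(1) b(3)] obtain U V where
      UV: "\<forall>i\<in>S. U i \<in> F t \<and> V i \<in> F t \<and> (\<forall>k\<in>S. f i < f k \<longrightarrow> U i k = V i k)"
      and prod: "b / 8 ^ card S \<le> (\<Prod>i\<in>S. \<bar>V i i - U i i\<bar>)"
      by blast
    have "F t \<noteq> {}" "F s \<noteq> {}" using b by (auto simp: ennreal_le_iff2)
    then obtain u v where uv: "u \<in> F s" "v \<in> F t" by blast
    define U' where "U' i = (if i = x then u(x := s) else (U i)(x := t))" for i
    define V' where "V' i = (if i = x then v(x := t) else (V i)(x := t))" for i
    have "U' i \<in> E \<and> V' i \<in> E \<and> (\<forall>k\<in>insert x S. f i < f k \<longrightarrow> U' i k = V' i k)"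
      if "i \<in> insert x S" for i
    proof (cases "i = x")
      case True
      then show ?thesis
        using uv by (auto simp: U'_def V'_def F_def dest: leD[OF insert.hyps(2)])
    next
      case False
      then show ?thesis
        using UV that by (auto simp: U'_def V'_def F_def)
    qed
    moreover have "a / 8 ^ card (insert x S) \<le> (\<Prod>i\<in>insert x S. \<bar>V' i i - U' i i\<bar>)"
    proof -
      have "a / 8 ^ card (insert x S) = a / 8 / 8 ^ card S"
        using False insert.hyps by simp
      also have "\<dots> \<le> \<bar>t - s\<bar> * (b / 8 ^ card S)"
        unfolding times_divide_eq_right by (rule divide_right_mono[OF b(4)]) simp
      also have "\<dots> \<le> \<bar>t - s\<bar> * (\<Prod>i\<in>S. \<bar>V i i - U i i\<bar>)"
        by (intro mult_left_mono prod) auto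
      also have "(\<Prod>i\<in>S. \<bar>V i i - U i i\<bar>) = (\<Prod>i\<in>S. \<bar>V' i i - U' i i\<bar>)"
        by (intro prod.cong refl) (use False in \<open>auto simp: U'_def V'_def\<close>)
      also have "\<bar>t - s\<bar> * \<dots> = (\<Prod>i\<in>insert x S. \<bar>V' i i - U' i i\<bar>)"
        using False insert.hyps by (simp add: U'_def V'_def)
      finally show ?thesis .
    qed
    ultimately show ?thesis by blast
  qed
qed

lemma lebesgue_staggered_pairs:
  fixes E :: "'a::euclidean_space set" and f :: "'a \<Rightarrow> 'r::linorder"
  assumes E: "E \<in> sets lebesgue" "emeasure lebesgue E < \<infinity>" "0 < measure lebesgue E"
  shows "\<exists>U V. (\<forall>b\<in>Basis. U b \<in> E \<and> V b \<in> E \<and> (\<forall>c\<in>Basis. f b < f c \<longrightarrow> U b \<bullet> c = V b \<bullet> c)) \<and>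
    measure lebesgue E / 8 ^ DIM('a) \<le> (\<Prod>b\<in>Basis. \<bar>(V b - U b) \<bullet> b\<bar>)"
proof -
  \<comment> \<open>A Borel subset of \<open>E\<close> with the same measure; its preimage in the
    product of lines is measurable.\<close>
  define S where "S = main_part lborel E"
  have S[measurable]: "S \<in> sets borel" using main_part_sets[OF E(1)] by (simp add: S_def)
  have SE: "S \<subseteq> E" using main_part_null_part_Un[OF E(1)] by (auto simp: S_def)
  let ?P = "\<Pi>\<^sub>M b\<in>(Basis::'a set). (lborel :: real measure)"
  let ?h = "\<lambda>y. \<Sum>b\<in>(Basis::'a set). y b *\<^sub>R b"
  define E' where "E' = ?h -` S \<inter> space ?P"
  have [measurable]: "?h \<in> ?P \<rightarrow>\<^sub>M borel" by measurable
  have E'[measurable]: "E' \<in> sets ?P" unfolding E'_def by measurable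
  have "ennreal (measure lebesgue E) = emeasure lebesgue E"
    using E by (simp add: emeasure_eq_ennreal_measure)
  also have "\<dots> = emeasure lborel S"
    using E by (simp add: S_def emeasure_completion)
  also have "\<dots> = emeasure ?P E'"
    by (subst lborel_eq) (simp add: emeasure_distr E'_def)
  finally have "ennreal (measure lebesgue E) \<le> emeasure ?P E'" by simp
  from PiM_lborel_staggered_pairs[OF finite_Basis E' E(3) this, of f]
  obtain U V where UV: "\<forall>i\<in>Basis. U i \<in> E' \<and> V i \<in> E' \<and> (\<forall>k\<in>Basis. f i < f k \<longrightarrow> U i k = V i k)"
    and prod: "measure lebesgue E / 8 ^ DIM('a) \<le> (\<Prod>i\<in>Basis. \<bar>V i i - U i i\<bar>)"
    by blast
  show ?thesis
  proof (intro exI conjI)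
    show "\<forall>b\<in>Basis. ?h (U b) \<in> E \<and> ?h (V b) \<in> E \<and>
        (\<forall>c\<in>Basis. f b < f c \<longrightarrow> ?h (U b) \<bullet> c = ?h (V b) \<bullet> c)"
      using UV SE by (auto simp: E'_def)
    show "measure lebesgue E / 8 ^ DIM('a) \<le> (\<Prod>b\<in>Basis. \<bar>(?h (V b) - ?h (U b)) \<bullet> b\<bar>)"
      using prod by (simp add: inner_diff_left)
  qed
qed

section \<open>Determinants of staggered matrices and differences of determinants\<close>

text \<open>A permutation p with a nonzero term in the Leibniz expansion satisfies r (p i) <= r (t
  i) for all i. Both sides have the same sum over i, so equality holds throughout, and injectivity
  of \<open>r\<close> leaves only p = t.\<close>

lemma abs_det_staggered:
  fixes A :: "real^'n^'n" and r :: "'n \<Rightarrow> nat"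
  assumes r: "inj r" and t: "bij t" and zero: "\<And>i j. r (t i) < r j \<Longrightarrow> A$i$j = 0"
  shows "\<bar>det A\<bar> = (\<Prod>i\<in>UNIV. \<bar>A$i$t i\<bar>)"
proof -
  have "t permutes UNIV" using t by (simp add: permutes_univ bij_iff)
  have "(\<Prod>i\<in>UNIV. A$i$p i) = 0" if p: "p permutes UNIV" "p \<noteq> t" for p
  proof (rule ccontr)
    assume "(\<Prod>i\<in>UNIV. A$i$p i) \<noteq> 0"
    then have le: "r (p i) \<le> r (t i)" for i using zero[of i "p i"] by (auto simp: not_le[symmetric])
    have "(\<Sum>i\<in>UNIV. r (p i)) = (\<Sum>i\<in>UNIV. r (t i))"
      using sum.reindex_bij_betw[OF permutes_imp_bij[OF p(1)], of r] sum.reindex_bij_betw[OF t, of r]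
      by simp
    then have "r (p i) = r (t i)" for i
      using sum_mono_inv[of "\<lambda>i. r (p i)" UNIV "\<lambda>i. r (t i)" i] le by simp
    then show False using r p(2) by (auto simp: inj_def)
  qed
  then have "det A = (\<Sum>p\<in>{t}. of_int (sign p) * (\<Prod>i\<in>UNIV. A$i$p i))"
    unfolding det_def using \<open>t permutes UNIV\<close>
    by (intro sum.mono_neutral_right) (auto simp: finite_permutations)
  then show ?thesis by (simp add: abs_mult abs_prod sign_def)
qed

text \<open>Rows are replaced in increasing rank: switching from \<open>U x\<close> to \<open>V x\<close> then changes
  only row \<open>x\<close> and rows already replaced, so a difference of two determinants replaces row \<open>x\<close>.\<close>
lemma abs_det_differences_le:
  fixes U V :: "'n::finite \<Rightarrow> real^'n^'n" and r :: "'n \<Rightarrow> nat"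
  assumes r: "inj r"
    and high: "\<And>i k. r i < r k \<Longrightarrow> U i $ k = V i $ k"
    and M: "\<And>A. (\<And>i. A i = U i \<or> A i = V i) \<Longrightarrow> \<bar>det (\<Sum>i\<in>UNIV. A i)\<bar> \<le> M"
  shows "(\<And>i. A i = U i \<or> A i = V i) \<Longrightarrow>
    \<bar>det (\<chi> i. if r i < m then V i $ i - U i $ i else (\<Sum>j\<in>UNIV. A j) $ i)\<bar> \<le> 2 ^ m * M"
proof (induction m arbitrary: A)
  case 0
  then show ?case using M[of A] by (simp add: vec_nth_inverse del: sum_component)
next
  case (Suc m)
  let ?R = "\<lambda>k A i. if r i < k then V i $ i - U i $ i else (\<Sum>j\<in>UNIV. A j) $ i"
  have M0: "0 \<le> M" using M[of U] by force
  show ?case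
  proof (cases "\<exists>x. r x = m")
    \<comment> \<open>Ranks may have gaps; a rank that no row has leaves the matrix as it
      is.\<close>
    case False
    then have "r i < Suc m \<longleftrightarrow> r i < m" for i by (auto simp: less_Suc_eq)
    then have "\<bar>det (\<chi> i. ?R (Suc m) A i)\<bar> \<le> 2 ^ m * M" using Suc by simp
    also have "\<dots> \<le> 2 ^ Suc m * M" using M0 by (intro mult_right_mono) auto
    finally show ?thesis .
  next
    case True
    then obtain x where x: "r x = m" by blast
    let ?A = "\<lambda>Z. A(x := Z)"
    let ?c = "?R m (?A (U x))"
    have sum: "(\<Sum>j\<in>UNIV. ?A Z j) = Z + (\<Sum>j\<in>UNIV - {x}. A j)" for Z
      by (subst sum.remove[of _ x]) auto
    have low: "r i < m" if "i \<noteq> x" "\<not> m < r i" for i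
      using that x injD[OF r, of i x] by linarith
    have up: "V x $ i = U x $ i" if "i \<noteq> x" "\<not> r i < m" for i
    proof -
      have "r x < r i" using low[of i] that x by blast
      then show ?thesis using high by simp
    qed
    \<comment> \<open>Switching from \<open>U x\<close> to \<open>V x\<close> is visible in row
      \<open>x\<close> alone: rows of lower rank are already replaced, and in rows of higher rank
      \<open>U x\<close> and \<open>V x\<close> agree. Linearity of the determinant in row
      \<open>x\<close> then isolates the difference.\<close>
    have "(\<chi> i. ?R m (?A (V x)) i) =
        (\<chi> i. if i = x then (V x $ x - U x $ x) + (\<Sum>j\<in>UNIV. ?A (U x) j) $ x else ?c i)"
      using x by (auto simp: vec_eq_iff sum up simp del: fun_upd_apply)
    then have "det (\<chi> i. ?R m (?A (V x)) i) = det (\<chi> i. if i = x then V x $ x - U x $ x else ?c i)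
        + det (\<chi> i. if i = x then (\<Sum>j\<in>UNIV. ?A (U x) j) $ x else ?c i)"
      by (simp only: det_row_add)
    \<comment> \<open>The target matrix is built from \<open>A\<close>, whose value at
      \<open>x\<close> may be either matrix; the rows of rank above \<open>m\<close> do not see
      which.\<close>
    also have "(\<chi> i. if i = x then V x $ x - U x $ x else ?c i) = (\<chi> i. ?R (Suc m) A i)"
    proof -
      have "A x = U x \<or> A x = V x" using Suc.prems by blast
      moreover have "A = ?A (A x)" by simp
      ultimately have "(\<Sum>j\<in>UNIV. ?A (U x) j) $ i = (\<Sum>j\<in>UNIV. A j) $ i" if "m < r i" for i
        using sum[of "U x"] sum[of "A x"] high[of x i] that x
        by (auto simp del: fun_upd_apply)
      moreover have "r i < Suc m \<longleftrightarrow> r i < m \<or> i = x" for i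
        using low[of i] x by (auto simp: less_Suc_eq)
      ultimately show ?thesis using low by (auto simp: vec_eq_iff simp del: fun_upd_apply)
    qed
    also have "(\<chi> i. if i = x then (\<Sum>j\<in>UNIV. ?A (U x) j) $ x else ?c i) = (\<chi> i. ?c i)"
      using x by (auto simp: vec_eq_iff)
    finally have "\<bar>det (\<chi> i. ?R (Suc m) A i)\<bar> \<le> \<bar>det (\<chi> i. ?R m (?A (V x)) i)\<bar> + \<bar>det (\<chi> i. ?c i)\<bar>"
      by linarith
    also have "\<dots> \<le> 2 ^ m * M + 2 ^ m * M"
      by (intro add_mono Suc.IH) (use Suc.prems in auto)
    also have "\<dots> = 2 ^ Suc m * M" by (simp add: algebra_simps)
    finally show ?thesis .
  qed
qed

section \<open>A symmetric Latin square\<close>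

text \<open>The addition table of the integers modulo \<open>CARD('n)\<close>, carried over to
  \<open>'n\<close>. By symmetry its columns are permutations too.\<close>

lemma ex_symmetric_latin_square:
  "\<exists>s :: 'n::finite \<Rightarrow> 'n \<Rightarrow> 'n. (\<forall>p j. s p j = s j p) \<and> (\<forall>p. bij (s p))"
proof -
  obtain h :: "'n \<Rightarrow> nat" where h: "bij_betw h UNIV {0..<CARD('n)}"
    using ex_bij_betw_finite_nat[OF finite_class.finite_UNIV] by blast
  define g where "g = the_inv_into UNIV h"
  define s where "s p j = g ((h p + h j) mod CARD('n))" for p j
  have hg: "h (g m) = m" if "m < CARD('n)" for m
    using f_the_inv_into_f_bij_betw[OF h, of m] that by (simp add: g_def)
  have hs: "h (s p j) = (h p + h j) mod CARD('n)" for p j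
    unfolding s_def by (rule hg) simp
  have lt: "h j < CARD('n)" for j using bij_betwE[OF h] by simp
  have "inj (s p)" for p
  proof (rule injI)
    fix i j assume "s p i = s p j"
    then have "(int (h p) + int (h i)) mod int CARD('n) = (int (h p) + int (h j)) mod int CARD('n)"
      using hs[of p i] hs[of p j] by (metis of_nat_add zmod_int)
    from mod_diff_cong[OF this refl[of "int (h p) mod int CARD('n)"]]
    have "int (h i) mod int CARD('n) = int (h j) mod int CARD('n)" by simp
    then have "h i = h j" using lt by simp
    then show "i = j" using h by (auto simp: bij_betw_def inj_def)
  qed
  then have "bij (s p)" for p by (simp add: bij_def finite_UNIV_inj_surj)
  moreover have "s p j = s j p" for p j by (simp add: s_def add.commute)
  ultimately show ?thesis by blast
qed

section \<open>Staggered pairs of matrices\<close>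

text \<open>Positions are ranked lexicographically, row first. The resulting agreement at later
  positions splits into agreement on all later rows, which serves the expansion of determinants, and
  on later entries of the same row, which serves triangularity.\<close>

lemma lebesgue_matrix_staggered_pairs:
  fixes E :: "(real^'n^'n) set" and h :: "'n \<Rightarrow> nat"
  assumes E: "E \<in> sets lebesgue" "emeasure lebesgue E < \<infinity>" "0 < measure lebesgue E"
    and h: "\<And>i. h i < CARD('n)"
  obtains U V where "\<And>i j. U i j \<in> E" "\<And>i j. V i j \<in> E"
    "\<And>i j k. h i < h k \<Longrightarrow> U i j $ k = V i j $ k"
    "\<And>i j l. h j < h l \<Longrightarrow> U i j $ i $ l = V i j $ i $ l"
    "measure lebesgue E / 8 ^ (CARD('n)^2) \<le> (\<Prod>i\<in>UNIV. \<Prod>j\<in>UNIV. \<bar>(V i j - U i j) $ i $ j\<bar>)"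
proof -
  define e :: "'n \<Rightarrow> 'n \<Rightarrow> real^'n^'n" where "e i j = axis i (axis j 1)" for i j
  have e: "e i j \<in> Basis" for i j by (simp add: e_def)
  have inner_e: "A \<bullet> e i j = A $ i $ j" for A i j by (simp add: e_def inner_axis)
  have Basis: "(Basis :: (real^'n^'n) set) = case_prod e ` UNIV"
  proof (rule equalityI)
    have "axis i (axis j 1) \<in> range (case_prod e)" for i j
      by (rule range_eqI[of _ _ "(i, j)"]) (simp add: e_def)
    then show "Basis \<subseteq> range (case_prod e)" by (auto simp: Basis_vec_def)
    show "range (case_prod e) \<subseteq> Basis" using e by auto
  qed
  have inj: "inj (case_prod e)"
    by (auto simp: inj_def e_def axis_eq_axis)
  \<comment> \<open>The lexicographic rank of a position, stored as a matrix: the inner product with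
    \<open>w\<close> ranks a basis element without decoding its two indices.\<close>
  define w :: "real^'n^'n" where "w = (\<chi> i j. real (h i * CARD('n) + h j))"
  obtain U V where UV: "\<forall>b\<in>Basis. U b \<in> E \<and> V b \<in> E \<and>
      (\<forall>c\<in>Basis. w \<bullet> b < w \<bullet> c \<longrightarrow> U b \<bullet> c = V b \<bullet> c)"
    and prod: "measure lebesgue E / 8 ^ DIM(real^'n^'n) \<le> (\<Prod>b\<in>Basis. \<bar>(V b - U b) \<bullet> b\<bar>)"
    using lebesgue_staggered_pairs[OF E, of "\<lambda>b. w \<bullet> b"] by blast
  have U: "U (e i j) \<in> E" and V: "V (e i j) \<in> E"
    and eq: "w \<bullet> e i j < w \<bullet> e k l \<Longrightarrow> U (e i j) \<bullet> e k l = V (e i j) \<bullet> e k l" for i j k l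
    using UV e by blast+
  have eq': "U (e i j) $ k $ l = V (e i j) $ k $ l"
    if "h i * CARD('n) + h j < h k * CARD('n) + h l" for i j k l
    using eq[of i j k l] that unfolding inner_e by (simp add: w_def flip: of_nat_mult of_nat_add)
  \<comment> \<open>As \<open>h j\<close> is below \<open>CARD('n)\<close>, all ranks in one row
    precede those of any later row.\<close>
  have row: "h i * CARD('n) + h j < h k * CARD('n) + h l" if "h i < h k" for i j k l
  proof -
    have "h i * CARD('n) + h j < Suc (h i) * CARD('n)" using h[of j] by simp
    also have "\<dots> \<le> h k * CARD('n)" using that by (intro mult_right_mono) auto
    finally show ?thesis by simp
  qed
  have "(\<Prod>b\<in>Basis. \<bar>(V b - U b) \<bullet> b\<bar>) = (\<Prod>(i, j)\<in>UNIV. \<bar>(V (e i j) - U (e i j)) $ i $ j\<bar>)"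
    unfolding Basis by (subst prod.reindex[OF inj]) (simp add: case_prod_beta inner_e del: vector_minus_component)
  also have "\<dots> = (\<Prod>i\<in>UNIV. \<Prod>j\<in>UNIV. \<bar>(V (e i j) - U (e i j)) $ i $ j\<bar>)"
    by (subst prod.cartesian_product) simp
  finally have "measure lebesgue E / 8 ^ (CARD('n)^2) \<le> \<dots>"
    using prod by (simp add: power2_eq_square)
  then show thesis
    using U V eq' row
    by (intro that[of "\<lambda>i j. U (e i j)" "\<lambda>i j. V (e i j)"]) (auto simp: vec_eq_iff)
qed

section \<open>Geometric mean over the Latin square\<close>

lemma prod_measure_powr_le_det_bound:
  fixes E :: "'n::finite \<Rightarrow> (real^'n^'n) set"
  assumes E: "\<And>j. E j \<in> sets lebesgue" "\<And>j. emeasure lebesgue (E j) < \<infinity>"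
    "\<And>j. 0 < measure lebesgue (E j)"
    and M: "\<And>A. (\<And>j. A j \<in> E j) \<Longrightarrow> \<bar>det (\<Sum>j\<in>UNIV. A j)\<bar> \<le> M"
  shows "(\<Prod>j\<in>UNIV. measure lebesgue (E j) powr (1 / real (CARD('n)^2))) \<le> 16 ^ CARD('n) * M"
proof -
  let ?n = "CARD('n)"
  obtain h :: "'n \<Rightarrow> nat" where h: "bij_betw h UNIV {0..<?n}"
    using ex_bij_betw_finite_nat[OF finite_class.finite_UNIV] by blast
  have inj_h: "inj h" and h_less: "h i < ?n" for i
    using h bij_betwE[OF h] by (auto simp: bij_betw_def)
  \<comment> \<open>Bundling the properties lets one choice select the pairs for all
    \<open>j\<close> together.\<close>
  define good where "good j U V \<longleftrightarrow> (\<forall>i k. U i k \<in> E j \<and> V i k \<in> E j) \<and>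
    (\<forall>i k l. h i < h l \<longrightarrow> U i k $ l = V i k $ l) \<and>
    (\<forall>i k l. h k < h l \<longrightarrow> U i k $ i $ l = V i k $ i $ l) \<and>
    measure lebesgue (E j) / 8 ^ (?n^2) \<le> (\<Prod>i\<in>UNIV. \<Prod>k\<in>UNIV. \<bar>(V i k - U i k) $ i $ k\<bar>)" for j U V
  have "\<exists>U V. good j U V" for j
  proof (rule lebesgue_matrix_staggered_pairs[where h = h, OF E[of j] h_less])
    fix U V
    assume "\<And>i k. U i k \<in> E j" "\<And>i k. V i k \<in> E j"
      "\<And>i k l. h i < h l \<Longrightarrow> U i k $ l = V i k $ l"
      "\<And>i k l. h k < h l \<Longrightarrow> U i k $ i $ l = V i k $ i $ l"
      "measure lebesgue (E j) / 8 ^ (?n^2) \<le> (\<Prod>i\<in>UNIV. \<Prod>k\<in>UNIV. \<bar>(V i k - U i k) $ i $ k\<bar>)"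
    then have "good j U V" unfolding good_def by (intro conjI allI impI)
    then show ?thesis by blast
  qed
  then obtain U V where "\<And>j. good j (U j) (V j)" by metis
  then have UE: "U j i k \<in> E j" and VE: "V j i k \<in> E j"
    and rows: "h i < h l \<Longrightarrow> U j i k $ l = V j i k $ l"
    and cols: "h k < h l \<Longrightarrow> U j i k $ i $ l = V j i k $ i $ l"
    and vol: "measure lebesgue (E j) / 8 ^ (?n^2) \<le> (\<Prod>i\<in>UNIV. \<Prod>k\<in>UNIV. \<bar>(V j i k - U j i k) $ i $ k\<bar>)"
    for i j k l unfolding good_def by blast+
  define d where "d j i k = \<bar>(V j i k - U j i k) $ i $ k\<bar>" for j i k
  have transversal: "(\<Prod>j\<in>UNIV. d j (s j) (t j)) \<le> 2 ^ ?n * M" if s: "bij s" and t: "bij t" for s t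
  proof -
    define s' where "s' = inv s"
    have s': "s' (s j) = j" "s (s' i) = i" for i j
      using s by (simp_all add: s'_def bij_is_inj bij_is_surj surj_f_inv_f)
    have t': "bij (\<lambda>i. t (s' i))"
      using bij_comp[OF bij_imp_bij_inv[OF s] t] by (simp add: s'_def comp_def)
    \<comment> \<open>Reindexed by rows: row \<open>i\<close> is served by the set with index
      \<open>s' i\<close>, whose pair belongs to the position (i, t (s' i)).\<close>
    let ?U = "\<lambda>i. U (s' i) i (t (s' i))" and ?V = "\<lambda>i. V (s' i) i (t (s' i))"
    let ?D = "\<chi> i. ?V i $ i - ?U i $ i"
    have "(\<Prod>j\<in>UNIV. d j (s j) (t j)) = (\<Prod>i\<in>UNIV. \<bar>?D $ i $ t (s' i)\<bar>)"
      using prod.reindex_bij_betw[OF s, of "\<lambda>i. \<bar>?D $ i $ t (s' i)\<bar>"] by (simp add: d_def s')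
    also have "\<dots> = \<bar>det ?D\<bar>"
      by (rule abs_det_staggered[OF inj_h t', symmetric]) (use cols in simp)
    also have "\<dots> \<le> 2 ^ ?n * M"
    proof -
      \<comment> \<open>All ranks are below \<open>?n\<close>, so at this stage every row has been
        replaced.\<close>
      have "\<bar>det (\<chi> i. if h i < ?n then ?V i $ i - ?U i $ i else (\<Sum>j\<in>UNIV. ?U j) $ i)\<bar> \<le> 2 ^ ?n * M"
      proof (rule abs_det_differences_le[where U = ?U and V = ?V, OF inj_h])
        fix A assume A: "\<And>i. A i = ?U i \<or> A i = ?V i"
        have "A (s j) \<in> E j" for j using A[of "s j"] UE VE by (auto simp: s')
        then have "\<bar>det (\<Sum>j\<in>UNIV. A (s j))\<bar> \<le> M" by (rule M)
        then show "\<bar>det (\<Sum>i\<in>UNIV. A i)\<bar> \<le> M"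
          by (simp only: sum.reindex_bij_betw[OF s, of A])
      qed (use rows in auto)
      then show ?thesis using h_less by simp
    qed
    finally show ?thesis .
  qed
  obtain L :: "'n \<Rightarrow> 'n \<Rightarrow> 'n" where sym: "\<And>p j. L p j = L j p" and L: "\<And>p. bij (L p)"
    using ex_symmetric_latin_square by metis
  let ?m = "\<lambda>j. measure lebesgue (E j)"
  have "0 \<le> M" using M[of "\<lambda>j. U j j j"] UE by force
  have d0: "0 \<le> d j i k" for j i k by (simp add: d_def)
  have "(\<Prod>j\<in>UNIV. ?m j) / (8 ^ (?n^2)) ^ ?n = (\<Prod>j\<in>UNIV. ?m j / 8 ^ (?n^2))"
    by (simp add: prod_dividef)
  also have "\<dots> \<le> (\<Prod>j\<in>UNIV. \<Prod>i\<in>UNIV. \<Prod>k\<in>UNIV. d j i k)"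
    using vol E(3) by (intro prod_mono) (auto simp: d_def less_imp_le)
  \<comment> \<open>For fixed j, the pairs (L p j, L q j) run through every position exactly once,
    since by symmetry p and q both move along the permutation \<open>L j\<close>.\<close>
  also have "\<dots> = (\<Prod>j\<in>UNIV. \<Prod>p\<in>UNIV. \<Prod>q\<in>UNIV. d j (L p j) (L q j))"
  proof (rule prod.cong[OF refl])
    fix j
    have "(\<Prod>i\<in>UNIV. \<Prod>k\<in>UNIV. d j i k) = (\<Prod>p\<in>UNIV. \<Prod>k\<in>UNIV. d j (L j p) k)"
      by (rule prod.reindex_bij_betw[OF L, symmetric])
    also have "\<dots> = (\<Prod>p\<in>UNIV. \<Prod>q\<in>UNIV. d j (L j p) (L j q))"
      by (intro prod.cong refl prod.reindex_bij_betw[OF L, symmetric])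
    finally show "(\<Prod>i\<in>UNIV. \<Prod>k\<in>UNIV. d j i k) = (\<Prod>p\<in>UNIV. \<Prod>q\<in>UNIV. d j (L p j) (L q j))"
      by (simp only: sym[of j])
  qed
  also have "\<dots> = (\<Prod>p\<in>UNIV. \<Prod>j\<in>UNIV. \<Prod>q\<in>UNIV. d j (L p j) (L q j))"
    by (rule prod.swap)
  also have "\<dots> = (\<Prod>p\<in>UNIV. \<Prod>q\<in>UNIV. \<Prod>j\<in>UNIV. d j (L p j) (L q j))"
    by (intro prod.cong refl prod.swap)
  \<comment> \<open>For fixed p and q the inner product over j is a transversal with s =
    \<open>L p\<close> and t = \<open>L q\<close>; there are n^2 of them.\<close>
  also have "\<dots> \<le> (\<Prod>p\<in>(UNIV::'n set). \<Prod>q\<in>(UNIV::'n set). 2 ^ ?n * M)"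
    by (intro prod_mono conjI prod_nonneg transversal L d0)
  also have "\<dots> = (2 ^ ?n * M) ^ (?n^2)"
    by (simp add: power2_eq_square power_mult)
  finally have "(\<Prod>j\<in>UNIV. ?m j) \<le> (8 ^ (?n^2)) ^ ?n * (2 ^ ?n * M) ^ (?n^2)"
    by (simp add: field_simps)
  \<comment> \<open>Regrouped as an n^2-th power, the slicing loss 8^n joins the expansion loss 2^n
    to give 16^n after the root.\<close>
  also have "(8 ^ (?n^2)) ^ ?n = ((8::real) ^ ?n) ^ (?n^2)"
    by (simp only: mult.commute flip: power_mult)
  also have "\<dots> * (2 ^ ?n * M) ^ (?n^2) = (16 ^ ?n * M) ^ (?n^2)"
    by (simp add: mult.assoc[symmetric] flip: power_mult_distrib)
  finally have le: "(\<Prod>j\<in>UNIV. ?m j) \<le> (16 ^ ?n * M) ^ (?n^2)" .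
  have "(\<Prod>j\<in>UNIV. ?m j powr (1 / real (?n^2))) = (\<Prod>j\<in>UNIV. ?m j) powr (1 / real (?n^2))"
    by (rule prod_powr_distrib[symmetric])
  also have "\<dots> \<le> ((16 ^ ?n * M) ^ (?n^2)) powr (1 / real (?n^2))"
    using le by (intro powr_mono2) (auto intro!: prod_nonneg)
  also have "\<dots> = 16 ^ ?n * M"
  \<comment> \<open>\<open>powr_realpow\<close> asks for a positive base; for M = 0 both sides are
    0.\<close>
  proof (cases "M = 0")
    case False
    then have "0 < 16 ^ ?n * M" using \<open>0 \<le> M\<close> by simp
    then show ?thesis
      by (subst powr_realpow[symmetric]) (simp_all add: powr_powr)
  qed simp
  finally show ?thesis .
qed

theorem mainTheorem1:
  "\<exists>C::real. \<forall>E :: 'n::finite \<Rightarrow> (real^'n^'n) set.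
     (\<forall>j. E j \<in> sets lebesgue \<and> emeasure lebesgue (E j) < \<infinity>) \<longrightarrow>
     ennreal (\<Prod>j\<in>UNIV. measure lebesgue (E j) powr (1 / real (CARD('n)^2)))
       \<le> ennreal C * (SUP A\<in>(\<Pi> j\<in>UNIV. E j). ennreal \<bar>det (\<Sum>j\<in>UNIV. A j)\<bar>)"
proof (intro exI allI impI)
  fix E :: "'n \<Rightarrow> (real^'n^'n) set"
  assume E: "\<forall>j. E j \<in> sets lebesgue \<and> emeasure lebesgue (E j) < \<infinity>"
  let ?P = "\<Prod>j\<in>UNIV. measure lebesgue (E j) powr (1 / real (CARD('n)^2))"
  let ?S = "SUP A\<in>(\<Pi> j\<in>UNIV. E j). ennreal \<bar>det (\<Sum>j\<in>UNIV. A j)\<bar>"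
  show "ennreal ?P \<le> ennreal (16 ^ CARD('n)) * ?S"
  proof (cases "\<exists>j. measure lebesgue (E j) = 0")
    case True
    \<comment> \<open>\<open>0 powr x\<close> is 0, so one null set annihilates the left side, even
      when some \<open>E j\<close> is empty and the supremum is 0.\<close>
    then have "?P = 0" by (intro prod_zero) auto
    then show ?thesis by (simp only: ennreal_0 zero_le)
  next
    case False
    then have pos: "0 < measure lebesgue (E j)" for j
      by (simp add: zero_less_measure_iff)
    show ?thesis
    proof (cases ?S)
      case (real M)
      have bound: "\<bar>det (\<Sum>j\<in>UNIV. A j)\<bar> \<le> M" if "\<And>j. A j \<in> E j" for A
      proof -
        have "ennreal \<bar>det (\<Sum>j\<in>UNIV. A j)\<bar> \<le> ?S"
          using that by (intro SUP_upper) auto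
        then show ?thesis using real by simp
      qed
      have "?P \<le> 16 ^ CARD('n) * M"
        by (rule prod_measure_powr_le_det_bound[OF _ _ pos bound]) (use E in blast)+
      then have "ennreal ?P \<le> ennreal (16 ^ CARD('n) * M)" by (rule ennreal_leI)
      then show ?thesis using real by (simp add: ennreal_mult)
    next
      case top
      \<comment> \<open>A positive constant times an infinite supremum is infinite.\<close>
      show ?thesis unfolding top by (simp add: ennreal_mult_top)
    qed
  qed
qed

end
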